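(* For every $n$ with $1\le n\le 10$, the Queen graph $G$ of size $n$ has $\alpha_{\mathrm{od}}(G)=1$, and consequently also $\chi_{\mathrm{so}}(G)=n^2$.
   Context: The Queen graph of size $n$ has vertex set $\{1,\dots,n\}\times\{1,\dots,n\}$; two distinct vertices $(a,b),(a',b')$ are adjacent iff $a=a'$, or $b=b'$, or $a-a'=b-b'$, or $a-a'=b'-b$. $N(v)$ is the open neighborhood of $v$. An odd independent set is an independent set $S$ of vertices such that every vertex $v\notin S$ has either $N(v)\cap S=\varnothing$ or $|N(v)\cap S|$ odd; $\alpha_{\mathrm{od}}(G)$ is the largest cardinality of an odd independent set. A strong odd coloring is a proper vertex coloring such that for every vertex $v$, each color used in $N(v)$ appears an odd number of times in $N(v)$; $\chi_{\mathrm{so}}(G)$ is the minimum number of colors in a strong odd coloring. *)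

theory Defs
  imports "Graph_Theory.Pair_Digraph"
begin

text \<open>
  Finite simple graphs are rendered by the locale \<^locale>\<open>pair_graph\<close>: finite, loop-free
  digraphs whose arc set is symmetric, so that \<open>{u, v}\<close> is an edge iff \<open>(u, v)\<close> is an arc.
\<close>

definition queen_graph :: "nat \<Rightarrow> (int \<times> int) pair_pre_digraph" where
  "queen_graph n =
     (let V = {1..int n} \<times> {1..int n} in
      \<lparr> pverts = V,
        parcs = {((a, b), (a', b')) | a b a' b'.
           (a, b) \<in> V \<and> (a', b') \<in> V \<and> (a, b) \<noteq> (a', b') \<and>
           (a = a' \<or> b = b' \<or> a - a' = b - b' \<or> a - a' = b' - b)} \<rparr>)"

lemma pair_graph_queen_graph: "pair_graph (queen_graph n)"
proof
  have "parcs (queen_graph n) \<subseteq> pverts (queen_graph n) \<times> pverts (queen_graph n)"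
    by (auto simp: queen_graph_def Let_def)
  moreover show "finite (pverts (queen_graph n))"
    by (simp add: queen_graph_def Let_def)
  ultimately show "finite (parcs (queen_graph n))"
    by (meson finite_SigmaI finite_subset)
  show "symmetric (with_proj (queen_graph n))"
    by (auto simp: symmetric_def queen_graph_def Let_def sym_def)
qed (auto simp: queen_graph_def Let_def)

definition neighborhood :: "'a pair_pre_digraph \<Rightarrow> 'a \<Rightarrow> 'a set" where
  "neighborhood G v = {u \<in> pverts G. (v, u) \<in> parcs G}"

definition independent_set :: "'a pair_pre_digraph \<Rightarrow> 'a set \<Rightarrow> bool" where
  "independent_set G S \<longleftrightarrow> S \<subseteq> pverts G \<and> (\<forall>u\<in>S. \<forall>v\<in>S. (u, v) \<notin> parcs G)"

definition odd_independent_set :: "'a pair_pre_digraph \<Rightarrow> 'a set \<Rightarrow> bool" where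
  "odd_independent_set G S \<longleftrightarrow> independent_set G S \<and>
     (\<forall>v \<in> pverts G - S. neighborhood G v \<inter> S = {} \<or> odd (card (neighborhood G v \<inter> S)))"

definition odd_independence_number :: "'a pair_pre_digraph \<Rightarrow> nat" where
  "odd_independence_number G = Max (card ` {S. odd_independent_set G S})"

definition proper_coloring :: "'a pair_pre_digraph \<Rightarrow> ('a \<Rightarrow> nat) \<Rightarrow> bool" where
  "proper_coloring G c \<longleftrightarrow> (\<forall>(u, v) \<in> parcs G. c u \<noteq> c v)"

definition strong_odd_coloring :: "'a pair_pre_digraph \<Rightarrow> ('a \<Rightarrow> nat) \<Rightarrow> bool" where
  "strong_odd_coloring G c \<longleftrightarrow> proper_coloring G c \<and>
     (\<forall>v \<in> pverts G. \<forall>k \<in> c ` neighborhood G v. odd (card {u \<in> neighborhood G v. c u = k}))"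

definition strong_odd_chromatic_number :: "'a pair_pre_digraph \<Rightarrow> nat" where
  "strong_odd_chromatic_number G =
     (LEAST k. \<exists>c. strong_odd_coloring G c \<and> card (c ` pverts G) = k)"

text \<open>On finite simple graphs the maximum and the minimum are attained.\<close>

lemma (in pair_graph) odd_independence_number_attained:
  "\<exists>S. odd_independent_set G S \<and> card S = odd_independence_number G"
  "odd_independent_set G S \<Longrightarrow> card S \<le> odd_independence_number G"
proof -
  have "{S. odd_independent_set G S} \<subseteq> Pow (pverts G)"
    by (auto simp: odd_independent_set_def independent_set_def)
  then have fin: "finite (card ` {S. odd_independent_set G S})"
    by (meson finite_Pow_iff finite_imageI finite_subset pair_finite_verts)
  have "odd_independent_set G {}"
    by (simp add: odd_independent_set_def independent_set_def)
  then have "odd_independence_number G \<in> card ` {S. odd_independent_set G S}"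
    unfolding odd_independence_number_def using fin by (intro Max_in) auto
  then show "\<exists>S. odd_independent_set G S \<and> card S = odd_independence_number G"
    by auto
  show "card S \<le> odd_independence_number G" if "odd_independent_set G S"
    unfolding odd_independence_number_def using fin that by (intro Max_ge) auto
qed

lemma (in pair_graph) strong_odd_chromatic_number_attained:
  "\<exists>c. strong_odd_coloring G c \<and> card (c ` pverts G) = strong_odd_chromatic_number G"
  "strong_odd_coloring G c \<Longrightarrow> strong_odd_chromatic_number G \<le> card (c ` pverts G)"
proof -
  obtain c :: "'a \<Rightarrow> nat" where c: "inj_on c (pverts G)"
    using finite_imp_inj_to_nat_seg[OF pair_finite_verts] by blast
  have "odd (card {u \<in> neighborhood G v. c u = c w})" if "w \<in> neighborhood G v" for v w
  proof -
    have "{u \<in> neighborhood G v. c u = c w} = {w}"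
      using c that by (auto simp: neighborhood_def inj_on_def)
    then show ?thesis by simp
  qed
  moreover have "c u \<noteq> c v" if "(u, v) \<in> parcs G" for u v
  proof -
    have "u \<in> pverts G" "v \<in> pverts G" "u \<noteq> v"
      using that arc_fst_in_verts arc_snd_in_verts pair_no_loops by fastforce+
    then show ?thesis using c by (auto dest: inj_onD)
  qed
  ultimately have "strong_odd_coloring G c"
    by (auto simp: strong_odd_coloring_def proper_coloring_def)
  then show "\<exists>c. strong_odd_coloring G c \<and> card (c ` pverts G) = strong_odd_chromatic_number G"
    unfolding strong_odd_chromatic_number_def
    by (intro LeastI[where P = "\<lambda>k. \<exists>c. strong_odd_coloring G c \<and> card (c ` pverts G) = k"]) blast
  show "strong_odd_chromatic_number G \<le> card (c ` pverts G)" if "strong_odd_coloring G c" for c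
    unfolding strong_odd_chromatic_number_def using that by (intro Least_le) blast
qed

end

theory Submission
  imports Defs
begin

text \<open>
  The result holds on boards of every size, and the reason is a counting argument on the smallest
  rectangle that contains an odd independent set \<open>S\<close> of \<open>k \<ge> 2\<close> queens.

  The queens of \<open>S\<close> occupy \<open>k\<close> rows, \<open>k\<close> columns, \<open>k\<close> diagonals and \<open>k\<close> antidiagonals. A square
  outside \<open>S\<close> that lies on an occupied row and on an occupied column has at least two neighbours in
  \<open>S\<close>, hence a third one, so it lies on an occupied diagonal or antidiagonal. This consequence is
  all that is used of oddness; it is the locale \<open>queen_configuration\<close> below.

  Look at an occupied column. Each of the \<open>k\<close> occupied rows meets it in a square on an occupied
  diagonal or antidiagonal, and at the queen of that column there are both. So at least \<open>k + 1\<close>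
  occupied diagonals and antidiagonals cross this column inside the rectangle. Apply this to the
  leftmost and to the rightmost column: a diagonal or an antidiagonal can cross both only if the
  rectangle is at least as high as it is wide. With the same argument for rows the rectangle is a
  square. Then only one diagonal and one antidiagonal can cross both columns, so the total number of
  crossings is at most \<open>2 * k + 2\<close>, and equality holds throughout. Equality means that, on each side
  of the square, the lines cross exactly at the occupied rows (or columns), once each, except at
  the queen of that side, where a diagonal and an antidiagonal cross.

  Now sum positions instead of counting them. With the top left corner as origin, let the queen of
  the left column be \<open>(y, 0)\<close> and the queen of the top row \<open>(0, x)\<close>. The equalities express the sum
  of the occupied rows plus \<open>y\<close>, and the sum of the occupied columns plus \<open>x\<close>, through the
  differences and sums of coordinates that occur in \<open>S\<close>. Subtracting them gives \<open>x = y\<close>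
  (\<open>corner_occupied\<close>). Two such queens share an antidiagonal, so they are the same queen, in the
  corner. By symmetry there is a queen in the opposite corner too, and these two share a diagonal, a
  contradiction. So \<open>k \<le> 1\<close> (\<open>card_le_1\<close>).

  For the coloring, each color class of a strong odd coloring is an odd independent set, hence a
  single square.
\<close>

section \<open>Queens that cover the crossings of their rows and columns\<close>

text \<open>
  A finite set of pairwise non-attacking queens such that every crossing of an occupied row with an
  occupied column is on an occupied diagonal or antidiagonal (trivially so if a queen stands there).
  The queens are abstract elements with integer coordinates \<open>r\<close> and \<open>c\<close>; in this form the symmetries
  of the square and the translations are just other choices of the coordinate functions.
\<close>

locale queen_configuration =
  fixes S :: "'a set" and r c :: "'a \<Rightarrow> int"
  assumes finite_queens: "finite S"
    and inj_row: "inj_on r S"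
    and inj_column: "inj_on c S"
    and inj_diagonal: "inj_on (\<lambda>s. r s - c s) S"
    and inj_antidiagonal: "inj_on (\<lambda>s. r s + c s) S"
    and crossing_covered: "\<lbrakk>s \<in> S; s' \<in> S\<rbrakk> \<Longrightarrow>
      \<exists>u\<in>S. r u - c u = r s - c s' \<or> r u + c u = r s + c s'"
begin

lemma transpose: "queen_configuration S c r"
proof
  show "inj_on (\<lambda>s. c s - r s) S"
    using inj_diagonal unfolding inj_on_def by (smt (verit))
  show "inj_on (\<lambda>s. c s + r s) S"
    using inj_antidiagonal by (simp add: add.commute)
  show "\<exists>u\<in>S. c u - r u = c s - r s' \<or> c u + r u = c s + r s'" if "s \<in> S" "s' \<in> S" for s s'
    using crossing_covered[OF that(2,1)] by (smt (verit))
qed (fact finite_queens inj_row inj_column)+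

lemma translate: "queen_configuration S (\<lambda>s. r s - i) (\<lambda>s. c s - j)"
proof
  show "\<exists>u\<in>S. (r u - i) - (c u - j) = (r s - i) - (c s' - j) \<or>
              (r u - i) + (c u - j) = (r s - i) + (c s' - j)" if "s \<in> S" "s' \<in> S" for s s'
    using crossing_covered[OF that] by (smt (verit))
  show "inj_on (\<lambda>s. r s - i) S" "inj_on (\<lambda>s. c s - j) S"
    "inj_on (\<lambda>s. (r s - i) - (c s - j)) S" "inj_on (\<lambda>s. (r s - i) + (c s - j)) S"
    using inj_row inj_column inj_diagonal inj_antidiagonal
    unfolding inj_on_def by (smt (verit))+
qed (fact finite_queens)

lemma rotate_half_turn: "queen_configuration S (\<lambda>s. i - r s) (\<lambda>s. j - c s)"
proof
  show "\<exists>u\<in>S. (i - r u) - (j - c u) = (i - r s) - (j - c s') \<or>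
              (i - r u) + (j - c u) = (i - r s) + (j - c s')" if "s \<in> S" "s' \<in> S" for s s'
    using crossing_covered[OF that] by (smt (verit))
  show "inj_on (\<lambda>s. i - r s) S" "inj_on (\<lambda>s. j - c s) S"
    "inj_on (\<lambda>s. (i - r s) - (j - c s)) S" "inj_on (\<lambda>s. (i - r s) + (j - c s)) S"
    using inj_row inj_column inj_diagonal inj_antidiagonal
    unfolding inj_on_def by (smt (verit))+
qed (fact finite_queens)

text \<open>
  The queens whose diagonal, respectively antidiagonal, crosses column \<open>j\<close> in a row between \<open>0\<close> and
  \<open>m\<close>. The crossing is in row \<open>r s - c s + j\<close>, respectively \<open>r s + c s - j\<close>.
\<close>

definition diagonals_through :: "int \<Rightarrow> int \<Rightarrow> 'a set" where
  "diagonals_through m j = {s \<in> S. r s - c s + j \<in> {0..m}}"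

definition antidiagonals_through :: "int \<Rightarrow> int \<Rightarrow> 'a set" where
  "antidiagonals_through m j = {s \<in> S. r s + c s - j \<in> {0..m}}"

lemma finite_lines_through [simp]:
  "finite (diagonals_through m j)" "finite (antidiagonals_through m j)"
  using finite_queens by (auto simp: diagonals_through_def antidiagonals_through_def)

lemma
  assumes q: "q \<in> S" and rows: "r ` S \<subseteq> {0..m}"
  shows column_crossings:
      "card S + 1 \<le> card (diagonals_through m (c q)) + card (antidiagonals_through m (c q))"
    and column_crossings_eq:
      "card (diagonals_through m (c q)) + card (antidiagonals_through m (c q)) = card S + 1 \<Longrightarrow>
       sum r S + r q = (\<Sum>s\<in>diagonals_through m (c q). r s - c s + c q)
                     + (\<Sum>s\<in>antidiagonals_through m (c q). r s + c s - c q)"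
proof -
  let ?P = "diagonals_through m (c q)" and ?A = "antidiagonals_through m (c q)"
  let ?f = "\<lambda>s. r s - c s + c q" and ?g = "\<lambda>s. r s + c s - c q"
  let ?U = "?f ` ?P" and ?V = "?g ` ?A"
  have f: "inj_on ?f ?P" and g: "inj_on ?g ?A"
    using inj_diagonal inj_antidiagonal
    by (auto simp: inj_on_def diagonals_through_def antidiagonals_through_def)
  have cards: "card (r ` S) = card S" "card ?U = card ?P" "card ?V = card ?A"
    using inj_row f g by (simp_all add: card_image)
  have sums: "\<Sum>(r ` S) = sum r S" "\<Sum>?U = sum ?f ?P" "\<Sum>?V = sum ?g ?A"
    using inj_row f g by (simp_all add: sum.reindex)
  have sub: "r ` S \<subseteq> ?U \<union> ?V"
  proof
    fix a assume "a \<in> r ` S"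
    then obtain s where s: "s \<in> S" "a = r s" by blast
    then obtain u where u: "u \<in> S" "?f u = a \<or> ?g u = a"
      using crossing_covered[OF s(1) q] by force
    have "a \<in> {0..m}" using s rows by blast
    then show "a \<in> ?U \<union> ?V"
      using u unfolding diagonals_through_def antidiagonals_through_def by blast
  qed
  have "r q \<in> {0..m}" using q rows by blast
  then have "q \<in> ?P" "q \<in> ?A"
    using q by (simp_all add: diagonals_through_def antidiagonals_through_def)
  then have rq: "r q \<in> ?U \<inter> ?V" by (auto intro!: image_eqI[of _ _ q])
  have split: "card ?U + card ?V = card (?U \<union> ?V) + card (?U \<inter> ?V)"
    by (rule card_Un_Int) auto
  have union: "card (r ` S) \<le> card (?U \<union> ?V)" by (rule card_mono[OF _ sub]) auto
  have inter: "1 \<le> card (?U \<inter> ?V)"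
    using card_mono[of "?U \<inter> ?V" "{r q}"] rq by simp
  show "card S + 1 \<le> card ?P + card ?A"
    using cards split union inter by linarith
  assume "card ?P + card ?A = card S + 1"
  then have "card (r ` S) = card (?U \<union> ?V)" and "card (?U \<inter> ?V) = 1"
    using cards split union inter by linarith+
  then have "r ` S = ?U \<union> ?V" and inter_eq: "{r q} = ?U \<inter> ?V"
    by (intro card_subset_eq; use sub rq in simp)+
  then have "\<Sum>(r ` S) + r q = \<Sum>(?U \<union> ?V) + \<Sum>(?U \<inter> ?V)"
    by (simp flip: inter_eq)
  also have "\<dots> = \<Sum>?U + \<Sum>?V" by (rule sum.union_inter) auto
  finally show "sum r S + r q = sum ?f ?P + sum ?g ?A" using sums by simp
qed

section \<open>The bounding rectangle is a square with queens in its corners\<close>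

text \<open>
  Both outer columns together are crossed at least \<open>2 * card S + 2\<close> times, so at least one
  diagonal or antidiagonal crosses both of them inside the rectangle.
\<close>

lemma width_le_height:
  assumes rows: "r ` S \<subseteq> {0..m}" and "0 \<in> c ` S" "w \<in> c ` S"
  shows "w \<le> m"
proof (rule ccontr)
  assume "\<not> w \<le> m"
  obtain q q' where q: "q \<in> S" "c q = 0" and q': "q' \<in> S" "c q' = w"
    using assms by force
  have "diagonals_through m 0 \<inter> diagonals_through m w = {}"
       "antidiagonals_through m 0 \<inter> antidiagonals_through m w = {}"
    using \<open>\<not> w \<le> m\<close> by (auto simp: diagonals_through_def antidiagonals_through_def)
  then have "card (diagonals_through m 0) + card (diagonals_through m w)
               = card (diagonals_through m 0 \<union> diagonals_through m w)"
            "card (antidiagonals_through m 0) + card (antidiagonals_through m w)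
               = card (antidiagonals_through m 0 \<union> antidiagonals_through m w)"
    by (simp_all add: card_Un_disjoint)
  moreover have "card (diagonals_through m 0 \<union> diagonals_through m w) \<le> card S"
                "card (antidiagonals_through m 0 \<union> antidiagonals_through m w) \<le> card S"
    using finite_queens
    by (auto intro!: card_mono simp: diagonals_through_def antidiagonals_through_def)
  ultimately show False
    using column_crossings[OF q(1) rows] column_crossings[OF q'(1) rows] q q' by simp
qed

text \<open>
  In a bounding square only its main diagonal and main antidiagonal cross both outer columns, so the
  bound on the crossings is attained.
\<close>

lemma column_crossings_tight:
  assumes rows: "r ` S \<subseteq> {0..m}" and "0 \<in> c ` S" "m \<in> c ` S"
  shows "card (diagonals_through m 0) + card (antidiagonals_through m 0) = card S + 1"
proof -
  let ?P = "diagonals_through m" and ?A = "antidiagonals_through m"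
  obtain q q' where q: "q \<in> S" "c q = 0" and q': "q' \<in> S" "c q' = m"
    using assms by force
  have "card (?P 0 \<inter> ?P m) \<le> card {0::int}"
  proof (rule card_inj_on_le)
    show "inj_on (\<lambda>s. r s - c s) (?P 0 \<inter> ?P m)"
      by (rule inj_on_subset[OF inj_diagonal]) (auto simp: diagonals_through_def)
  qed (auto simp: diagonals_through_def)
  moreover have "card (?A 0 \<inter> ?A m) \<le> card {m}"
  proof (rule card_inj_on_le)
    show "inj_on (\<lambda>s. r s + c s) (?A 0 \<inter> ?A m)"
      by (rule inj_on_subset[OF inj_antidiagonal]) (auto simp: antidiagonals_through_def)
  qed (auto simp: antidiagonals_through_def)
  moreover have "card (?P 0 \<union> ?P m) \<le> card S" "card (?A 0 \<union> ?A m) \<le> card S"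
    using finite_queens
    by (auto intro!: card_mono simp: diagonals_through_def antidiagonals_through_def)
  moreover have "card (?P 0) + card (?P m) = card (?P 0 \<union> ?P m) + card (?P 0 \<inter> ?P m)"
                "card (?A 0) + card (?A m) = card (?A 0 \<union> ?A m) + card (?A 0 \<inter> ?A m)"
    by (rule card_Un_Int; simp)+
  ultimately show ?thesis
    using column_crossings[OF q(1) rows] column_crossings[OF q'(1) rows] q q' by simp
qed

lemma corner_occupied:
  assumes rows: "r ` S \<subseteq> {0..m}" "0 \<in> r ` S" "m \<in> r ` S"
    and columns: "c ` S \<subseteq> {0..m}" "0 \<in> c ` S" "m \<in> c ` S"
  shows "\<exists>q\<in>S. r q = 0 \<and> c q = 0"
proof -
  interpret T: queen_configuration S c r by (rule transpose)
  let ?P = "diagonals_through m 0" and ?P' = "T.diagonals_through m 0"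
    and ?A = "antidiagonals_through m 0"
  obtain p q where p: "p \<in> S" "c p = 0" and q: "q \<in> S" "r q = 0"
    using assms by force
  have A: "T.antidiagonals_through m 0 = ?A"
    by (simp add: antidiagonals_through_def T.antidiagonals_through_def add.commute)
  have rsum: "sum r S + r p = (\<Sum>s\<in>?P. r s - c s) + (\<Sum>s\<in>?A. r s + c s)"
    using column_crossings_eq[OF p(1) rows(1)] column_crossings_tight[OF rows(1) columns(2,3)] p
    by simp
  have csum: "sum c S + c q = (\<Sum>s\<in>?P'. c s - r s) + (\<Sum>s\<in>?A. r s + c s)"
    using T.column_crossings_eq[OF q(1) columns(1)]
      T.column_crossings_tight[OF columns(1) rows(2,3)] q A
    by (simp add: add.commute)
  \<comment> \<open>Each diagonal crosses the left column or the top row inside the square. Only the main diagonal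
      does both, and it contributes \<open>0\<close> to the sum.\<close>
  have "?P \<union> ?P' = S"
    using rows(1) columns(1)
    by (force simp: diagonals_through_def T.diagonals_through_def image_subset_iff)
  moreover have "(\<Sum>s\<in>?P \<inter> ?P'. r s - c s) = 0"
    by (rule sum.neutral) (auto simp: diagonals_through_def T.diagonals_through_def)
  ultimately have "(\<Sum>s\<in>?P. r s - c s) + (\<Sum>s\<in>?P'. r s - c s) = (\<Sum>s\<in>S. r s - c s)"
    using sum.union_inter[of ?P ?P' "\<lambda>s. r s - c s"] by simp
  then have "r p = c q"
    using rsum csum by (simp add: sum_subtractf)
  then have "p = q"
    using inj_onD[OF inj_antidiagonal, of p q] p q by simp
  then show ?thesis using p q by blast
qed

theorem card_le_1: "card S \<le> 1"
proof (cases "S = {}")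
  case False
  \<comment> \<open>Translate the bounding rectangle to the origin.\<close>
  define i j where "i = Min (r ` S)" and "j = Min (c ` S)"
  define R C where "R = (\<lambda>s. r s - i)" and "C = (\<lambda>s. c s - j)"
  define m w where "m = Max (R ` S)" and "w = Max (C ` S)"
  interpret Q: queen_configuration S R C
    unfolding R_def C_def by (rule translate)
  interpret T: queen_configuration S C R by (rule Q.transpose)
  have "i \<in> r ` S" "j \<in> c ` S"
    unfolding i_def j_def using False finite_queens by (simp_all add: Min_in)
  then have zero: "0 \<in> R ` S" "0 \<in> C ` S" by (auto simp: R_def C_def)
  have max: "m \<in> R ` S" "w \<in> C ` S"
    unfolding m_def w_def using False finite_queens by (simp_all add: Max_in)
  have "0 \<le> R s \<and> R s \<le> m" "0 \<le> C s \<and> C s \<le> w" if "s \<in> S" for s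
    using that finite_queens by (simp_all add: m_def w_def) (simp_all add: R_def C_def i_def j_def)
  then have range: "R ` S \<subseteq> {0..m}" "C ` S \<subseteq> {0..w}" by auto
  have "w = m"
    using Q.width_le_height[OF range(1) zero(2) max(2)]
      T.width_le_height[OF range(2) zero(1) max(1)] by simp
  note C = range(2)[unfolded \<open>w = m\<close>] max(2)[unfolded \<open>w = m\<close>]
  obtain p where p: "p \<in> S" "R p = 0" "C p = 0"
    using Q.corner_occupied[OF range(1) zero(1) max(1) C(1) zero(2) C(2)] by blast
  interpret H: queen_configuration S "\<lambda>s. m - R s" "\<lambda>s. m - C s"
    by (rule Q.rotate_half_turn)
  have turn: "(\<lambda>s. m - f s) ` S \<subseteq> {0..m}" "0 \<in> (\<lambda>s. m - f s) ` S" "m \<in> (\<lambda>s. m - f s) ` S"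
    if "f ` S \<subseteq> {0..m}" "0 \<in> f ` S" "m \<in> f ` S" for f :: "'a \<Rightarrow> int"
  proof -
    have "(\<lambda>s. m - f s) ` S = (-) m ` f ` S" by (simp add: image_image)
    then show "(\<lambda>s. m - f s) ` S \<subseteq> {0..m}" "0 \<in> (\<lambda>s. m - f s) ` S" "m \<in> (\<lambda>s. m - f s) ` S"
      using that image_eqI[of 0 "(-) m" m "f ` S"] image_eqI[of m "(-) m" 0 "f ` S"] by auto
  qed
  have "\<exists>q\<in>S. m - R q = 0 \<and> m - C q = 0"
    by (rule H.corner_occupied[of m]) (intro turn range(1) zero max(1) C)+
  then obtain q where q: "q \<in> S" "R q = m" "C q = m" by auto
  have "p = q"
    using inj_onD[OF Q.inj_diagonal, of p q] p q by simp
  then have "m = 0" using p q by simp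
  then show ?thesis
    using card_inj_on_le[OF Q.inj_row range(1)] by simp
qed simp

end

section \<open>Odd independent sets and strong odd colorings\<close>

lemma pverts_queen_graph: "pverts (queen_graph n) = {1..int n} \<times> {1..int n}"
  by (simp add: queen_graph_def Let_def)

lemma parcs_queen_graph:
  "(u, v) \<in> parcs (queen_graph n) \<longleftrightarrow>
     u \<in> pverts (queen_graph n) \<and> v \<in> pverts (queen_graph n) \<and> u \<noteq> v \<and>
     (fst u = fst v \<or> snd u = snd v \<or> fst u - snd u = fst v - snd v \<or> fst u + snd u = fst v + snd v)"
  by (cases u; cases v) (auto simp: queen_graph_def Let_def)

lemma odd_independent_set_queen_configuration:
  assumes "odd_independent_set (queen_graph n) S"
  shows "queen_configuration S fst snd"
proof
  let ?G = "queen_graph n"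
  have sub: "S \<subseteq> pverts ?G"
    and indep: "\<And>u v. \<lbrakk>u \<in> S; v \<in> S\<rbrakk> \<Longrightarrow> (u, v) \<notin> parcs ?G"
    and odd: "\<And>v. \<lbrakk>v \<in> pverts ?G; v \<notin> S\<rbrakk> \<Longrightarrow>
                neighborhood ?G v \<inter> S = {} \<or> odd (card (neighborhood ?G v \<inter> S))"
    using assms by (auto simp: odd_independent_set_def independent_set_def)
  show "finite S" using sub by (rule finite_subset) (simp add: pverts_queen_graph)
  have apart: "u = v" if "u \<in> S" "v \<in> S"
    "fst u = fst v \<or> snd u = snd v \<or> fst u - snd u = fst v - snd v \<or> fst u + snd u = fst v + snd v"
    for u v
    using indep[OF that(1,2)] that sub by (auto simp only: parcs_queen_graph)
  show "inj_on fst S" "inj_on snd S"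
    "inj_on (\<lambda>s. fst s - snd s) S" "inj_on (\<lambda>s. fst s + snd s) S"
    by (rule inj_onI, rule apart; simp)+
  fix s s' assume s: "s \<in> S" "s' \<in> S"
  define v where "v = (fst s, snd s')"
  show "\<exists>u\<in>S. fst u - snd u = fst s - snd s' \<or> fst u + snd u = fst s + snd s'"
  proof (rule ccontr)
    assume no: "\<not> ?thesis"
    then have "v \<notin> S" by (auto simp: v_def)
    have v: "v \<in> pverts ?G"
      using s sub by (auto simp: v_def pverts_queen_graph)
    have "s \<noteq> s'" using \<open>v \<notin> S\<close> s by (auto simp: v_def)
    have "neighborhood ?G v \<inter> S = {s, s'}"
    proof (intro equalityI subsetI)
      fix u assume u: "u \<in> neighborhood ?G v \<inter> S"
      then have "fst u = fst s \<or> snd u = snd s'"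
        using no by (auto simp: neighborhood_def parcs_queen_graph v_def)
      then show "u \<in> {s, s'}" using apart[of u s] apart[of u s'] u s by auto
    next
      fix u assume "u \<in> {s, s'}"
      moreover have "v \<noteq> s" "v \<noteq> s'" using \<open>v \<notin> S\<close> s by auto
      ultimately show "u \<in> neighborhood ?G v \<inter> S"
        using s sub v by (auto simp: neighborhood_def parcs_queen_graph v_def)
    qed
    then show False using odd[OF v \<open>v \<notin> S\<close>] \<open>s \<noteq> s'\<close> by simp
  qed
qed

lemma odd_independent_set_singleton:
  assumes "v \<in> pverts G" and "(v, v) \<notin> parcs G"
  shows "odd_independent_set G {v}"
proof -
  have "neighborhood G u \<inter> {v} = {} \<or> neighborhood G u \<inter> {v} = {v}" for u by auto
  then have "neighborhood G u \<inter> {v} = {} \<or> odd (card (neighborhood G u \<inter> {v}))" for u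
    by (metis card_1_singleton_iff odd_one One_nat_def)
  then show ?thesis
    using assms by (auto simp: odd_independent_set_def independent_set_def)
qed

lemma odd_independent_set_color_class:
  assumes "strong_odd_coloring G c"
  shows "odd_independent_set G {u \<in> pverts G. c u = k}"
proof -
  have "neighborhood G v \<inter> {u \<in> pverts G. c u = k} = {u \<in> neighborhood G v. c u = k}" for v
    by (auto simp: neighborhood_def)
  then show ?thesis
    using assms
    by (fastforce simp: odd_independent_set_def independent_set_def strong_odd_coloring_def
        proper_coloring_def)
qed

text \<open>
  Every color class has at most one vertex, so the strong odd colorings are those with pairwise
  distinct colors.
\<close>

lemma (in pair_graph) strong_odd_chromatic_number_eq_card:
  assumes "odd_independence_number G = 1"
  shows "strong_odd_chromatic_number G = card (pverts G)"
proof -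
  obtain c where c: "strong_odd_coloring G c"
    and card: "card (c ` pverts G) = strong_odd_chromatic_number G"
    using strong_odd_chromatic_number_attained(1) by blast
  have "inj_on c (pverts G)"
  proof (rule inj_onI)
    fix u v assume uv: "u \<in> pverts G" "v \<in> pverts G" "c u = c v"
    have "card {w \<in> pverts G. c w = c v} \<le> 1"
      using odd_independence_number_attained(2)[OF odd_independent_set_color_class[OF c]] assms
      by simp
    then show "u = v"
      using uv card_le_Suc0_iff_eq[of "{w \<in> pverts G. c w = c v}"] by auto
  qed
  then show ?thesis using card by (simp add: card_image)
qed

theorem proposition22:
  fixes n :: nat
  assumes "1 \<le> n" and "n \<le> 10"
  shows "odd_independence_number (queen_graph n) = 1 \<and>
         strong_odd_chromatic_number (queen_graph n) = n ^ 2"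
proof -
  interpret pair_graph "queen_graph n" by (rule pair_graph_queen_graph)
  obtain S where S: "odd_independent_set (queen_graph n) S"
    "card S = odd_independence_number (queen_graph n)"
    using odd_independence_number_attained(1) by blast
  interpret queen_configuration S fst snd
    using S(1) by (rule odd_independent_set_queen_configuration)
  have "odd_independent_set (queen_graph n) {(1, 1)}"
    using assms by (intro odd_independent_set_singleton)
      (simp_all add: pverts_queen_graph parcs_queen_graph)
  from odd_independence_number_attained(2)[OF this]
  have "odd_independence_number (queen_graph n) = 1"
    using S(2) card_le_1 by simp
  moreover from this have "strong_odd_chromatic_number (queen_graph n) = n ^ 2"
    using strong_odd_chromatic_number_eq_card
    by (simp add: pverts_queen_graph card_cartesian_product power2_eq_square)
  ultimately show ?thesis by blast
qed

end
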